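(* Let $f,g:[a,b]\to\mathbb{R}$ be continuous and let $u:[a,b]\to\mathbb{R}$ be of bounded variation. Let $I_n: a=x_0<x_1<\cdots<x_{n-1}<x_n=b$ be a division of $[a,b]$ such that $u(x_{i+1})\neq u(x_i)$ for $i=0,\dots,n-1$. Then $$\int_a^b f(t)g(t)\,du(t)=S_n(f,g;u,I_n)+R_n(f,g;u,I_n),$$ where $$S_n(f,g;u,I_n):=\sum_{i=0}^{n-1}\frac{1}{u(x_{i+1})-u(x_i)}\int_{x_i}^{x_{i+1}}f(t)\,du(t)\cdot\int_{x_i}^{x_{i+1}}g(t)\,du(t),$$ and the remainder $R_n(f,g;u,I_n)$ satisfies $$\left|R_n(f,g;u,I_n)\right|\le \frac12\, v(f,I_n)\,\max_{0\le i\le n-1}\left\|g-\frac{1}{u(x_{i+1})-u(x_i)}\int_{x_i}^{x_{i+1}}g(s)\,du(s)\right\|_{[x_i,x_{i+1}],\infty}\bigvee_a^b(u).$$ The constant $\frac12$ is sharp in the sense that it cannot be replaced by a smaller constant (valid for all such $f,g,u,I_n$).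
   Context: All integrals $\int \cdot\,du$ are Riemann–Stieltjes integrals. $\bigvee_a^b(u)$ denotes the total variation of $u$ on $[a,b]$. For a function $h$ on $[c,d]$, $\|h\|_{[c,d],\infty}:=\sup_{t\in[c,d]}|h(t)|$. For the division $I_n$ put $M_i:=\sup_{t\in[x_i,x_{i+1}]}f(t)$, $m_i:=\inf_{t\in[x_i,x_{i+1}]}f(t)$ and $v(f,I_n):=\max_{0\le i\le n-1}(M_i-m_i)$. *)

theory Defs
  imports "HOL-Analysis.Analysis"
begin

(* Only the values x 0, ..., x n matter. The case n = 0 is admitted and occurs iff a = b. *)
definition interval_division :: "real \<Rightarrow> real \<Rightarrow> nat \<Rightarrow> (nat \<Rightarrow> real) \<Rightarrow> bool" where
  "interval_division a b n x \<longleftrightarrow> x 0 = a \<and> x n = b \<and> (\<forall>i<n. x i < x (Suc i))"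

definition variation_sums :: "real \<Rightarrow> real \<Rightarrow> (real \<Rightarrow> real) \<Rightarrow> real set" where
  "variation_sums a b u =
     {(\<Sum>i<n. \<bar>u (x (Suc i)) - u (x i)\<bar>) | n x. interval_division a b n x}"

definition bounded_variation :: "real \<Rightarrow> real \<Rightarrow> (real \<Rightarrow> real) \<Rightarrow> bool" where
  "bounded_variation a b u \<longleftrightarrow> bdd_above (variation_sums a b u)"

(* Meaningful only under bounded_variation, since Sup is unspecified on unbounded sets of reals. *)
definition total_variation :: "real \<Rightarrow> real \<Rightarrow> (real \<Rightarrow> real) \<Rightarrow> real" where
  "total_variation a b u = Sup (variation_sums a b u)"

(* The Riemann-Stieltjes integral as the limit of tagged sums when the mesh tends to 0
   (not along refinement of divisions). *)
definition has_rs_integral ::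
    "(real \<Rightarrow> real) \<Rightarrow> (real \<Rightarrow> real) \<Rightarrow> real \<Rightarrow> real \<Rightarrow> real \<Rightarrow> bool" where
  "has_rs_integral f u a b I \<longleftrightarrow>
     (\<forall>\<epsilon>>0. \<exists>\<delta>>0. \<forall>n x \<xi>.
        interval_division a b n x \<longrightarrow>
        (\<forall>i<n. x (Suc i) - x i < \<delta>) \<longrightarrow>
        (\<forall>i<n. \<xi> i \<in> {x i..x (Suc i)}) \<longrightarrow>
        \<bar>(\<Sum>i<n. f (\<xi> i) * (u (x (Suc i)) - u (x i))) - I\<bar> < \<epsilon>)"

definition rs_integrable :: "(real \<Rightarrow> real) \<Rightarrow> (real \<Rightarrow> real) \<Rightarrow> real \<Rightarrow> real \<Rightarrow> bool" where
  "rs_integrable f u a b \<longleftrightarrow> (\<exists>I. has_rs_integral f u a b I)"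

definition rs_integral :: "(real \<Rightarrow> real) \<Rightarrow> (real \<Rightarrow> real) \<Rightarrow> real \<Rightarrow> real \<Rightarrow> real" where
  "rs_integral f u a b = (THE I. has_rs_integral f u a b I)"

definition sup_norm_on :: "real \<Rightarrow> real \<Rightarrow> (real \<Rightarrow> real) \<Rightarrow> real" where
  "sup_norm_on c d h = (SUP t\<in>{c..d}. \<bar>h t\<bar>)"

definition max_oscillation :: "(real \<Rightarrow> real) \<Rightarrow> nat \<Rightarrow> (nat \<Rightarrow> real) \<Rightarrow> real" where
  "max_oscillation f n x =
     Max ((\<lambda>i. (SUP t\<in>{x i..x (Suc i)}. f t) - (INF t\<in>{x i..x (Suc i)}. f t)) ` {..<n})"

definition rs_mean :: "(real \<Rightarrow> real) \<Rightarrow> (real \<Rightarrow> real) \<Rightarrow> real \<Rightarrow> real \<Rightarrow> real" where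
  "rs_mean g u c d = 1 / (u d - u c) * rs_integral g u c d"

definition max_mean_deviation ::
    "(real \<Rightarrow> real) \<Rightarrow> (real \<Rightarrow> real) \<Rightarrow> nat \<Rightarrow> (nat \<Rightarrow> real) \<Rightarrow> real" where
  "max_mean_deviation g u n x =
     Max ((\<lambda>i. sup_norm_on (x i) (x (Suc i)) (\<lambda>t. g t - rs_mean g u (x i) (x (Suc i)))) ` {..<n})"

definition product_quadrature ::
    "(real \<Rightarrow> real) \<Rightarrow> (real \<Rightarrow> real) \<Rightarrow> (real \<Rightarrow> real) \<Rightarrow> nat \<Rightarrow> (nat \<Rightarrow> real) \<Rightarrow> real" where
  "product_quadrature f g u n x =
     (\<Sum>i<n. 1 / (u (x (Suc i)) - u (x i))
        * rs_integral f u (x i) (x (Suc i)) * rs_integral g u (x i) (x (Suc i)))"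

definition admissible ::
    "real \<Rightarrow> real \<Rightarrow> (real \<Rightarrow> real) \<Rightarrow> (real \<Rightarrow> real) \<Rightarrow> (real \<Rightarrow> real) \<Rightarrow> nat \<Rightarrow> (nat \<Rightarrow> real) \<Rightarrow> bool" where
  "admissible a b f g u n x \<longleftrightarrow>
     continuous_on {a..b} f \<and> continuous_on {a..b} g \<and> bounded_variation a b u \<and>
     interval_division a b n x \<and> (\<forall>i<n. u (x (Suc i)) \<noteq> u (x i))"

end

theory Submission
  imports Defs
begin

text \<open>
  On a single interval \<open>[c, d]\<close> with increment \<open>\<Delta> = u d - u c \<noteq> 0\<close> let \<open>\<mu> = (\<integral> g du) / \<Delta>\<close> be the mean
  of \<open>g\<close> and let \<open>k\<close> be the midpoint of the range of \<open>f\<close>. Since \<open>\<integral> (g - \<mu>) du = 0\<close>, a constant may be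
  subtracted from \<open>f\<close> at no cost, so that the quadrature error is a single integral
    \<open>\<integral> f g du - (\<integral> f du) (\<integral> g du) / \<Delta> = \<integral> (f - k) (g - \<mu>) du\<close>.
  Its first factor is at most half the oscillation of \<open>f\<close>, its second factor at most the sup norm of
  \<open>g - \<mu>\<close>, and an integral with respect to \<open>u\<close> is at most the sup norm of the integrand times the
  variation of \<open>u\<close> (\<open>product_quadrature_error_interval\<close>). Summation over the division uses that the
  integral is additive and the variation superadditive along divisions.

  The remaining work is the existence of \<open>\<integral> f du\<close> as a limit over the mesh, for continuous \<open>f\<close>.
  The limit is taken along a filter on tagged divisions, so that linearity, uniqueness, bounds and
  additivity are instances of general facts on limits. The Cauchy property
  (\<open>riemann_sums_close\<close>) compares two tagged divisions of \<open>[a, b]\<close> directly, without a common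
  refinement: if \<open>p\<close> is the smaller of the right endpoints of their first intervals, then restricting
  both to \<open>[p, b]\<close> changes the difference of the sums by \<open>(f \<xi> - f \<eta>) (u p - u a)\<close>, where \<open>\<xi>\<close> and \<open>\<eta>\<close>
  are the first tags and close to each other.

  The constant is attained by an integrator that jumps by 1 at both endpoints and is constant between
  them, for which \<open>\<integral> h du = h a + h b\<close>, together with \<open>f = g\<close> affine from \<open>-1\<close> to \<open>1\<close>: the error is 2,
  the oscillation 2, the deviation from the mean 1 and the variation 2.
\<close>

section \<open>Divisions and their concatenation\<close>

text \<open>Weak monotonicity only: the comparison of Riemann sums below creates degenerate intervals.\<close>

lemma division_mono:
  fixes x :: "nat \<Rightarrow> real"
  assumes "\<forall>i<n. x i \<le> x (Suc i)" "i \<le> j" "j \<le> n"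
  shows "x i \<le> x j"
  by (rule lift_Suc_mono_le_ivl[where N = "{..<n}"]) (use assms in auto)

lemma interval_division_weak: "interval_division a b n x \<Longrightarrow> \<forall>i<n. x i \<le> x (Suc i)"
  by (auto simp: interval_division_def intro: less_imp_le)

lemma interval_division_points:
  assumes "interval_division a b n x" "i \<le> n"
  shows "a \<le> x i" "x i \<le> b"
  using division_mono[OF interval_division_weak[OF assms(1)], of 0 i]
    division_mono[OF interval_division_weak[OF assms(1)], of i n] assms
  by (auto simp: interval_division_def)

lemma interval_division_subinterval:
  assumes "interval_division a b n x" "i < n"
  shows "x i < x (Suc i)" "{x i..x (Suc i)} \<subseteq> {a..b}"
proof -
  show "x i < x (Suc i)"
    using assms by (auto simp: interval_division_def)
  show "{x i..x (Suc i)} \<subseteq> {a..b}"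
    using interval_division_points(1)[OF assms(1), of i]
      interval_division_points(2)[OF assms(1), of "Suc i"] assms(2) by auto
qed

lemma interval_division_prefix: "interval_division a b (Suc n) x \<Longrightarrow> interval_division a (x n) n x"
  by (auto simp: interval_division_def)

lemma interval_division_pos: "interval_division a b n x \<Longrightarrow> a < b \<Longrightarrow> 0 < n"
  by (cases n) (auto simp: interval_division_def)

text \<open>The seam belongs to the second sequence, so the same operation concatenates the division points,
  where \<open>x n = y 0\<close>, and the tags, where there is no value \<open>\<xi> n\<close>.\<close>

definition join :: "nat \<Rightarrow> (nat \<Rightarrow> 'a) \<Rightarrow> (nat \<Rightarrow> 'a) \<Rightarrow> nat \<Rightarrow> 'a" where
  "join n x y = (\<lambda>i. if i < n then x i else y (i - n))"

lemma join_less: "i < n \<Longrightarrow> join n x y i = x i"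
  and join_add: "join n x y (n + i) = y i"
  and join_Suc_less: "x n = y 0 \<Longrightarrow> i < n \<Longrightarrow> join n x y (Suc i) = x (Suc i)"
  and join_Suc_add: "join n x y (Suc (n + i)) = y (Suc i)"
  by (auto simp: join_def not_less Suc_diff_le less_Suc_eq_le dest: le_antisym[OF Suc_leI])

lemmas join_simps = join_less join_add join_Suc_less join_Suc_add

lemma all_join:
  assumes "x n = y 0"
    and "\<forall>i<n. P (\<xi> i) (x i) (x (Suc i))" "\<forall>i<m. P (\<eta> i) (y i) (y (Suc i))"
  shows "\<forall>i<n+m. P (join n \<xi> \<eta> i) (join n x y i) (join n x y (Suc i))"
proof (intro allI impI)
  fix i assume i: "i < n + m"
  show "P (join n \<xi> \<eta> i) (join n x y i) (join n x y (Suc i))"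
  proof (cases "i < n")
    case True
    then show ?thesis using assms by (simp add: join_simps)
  next
    case False
    then obtain k where "i = n + k" by (metis le_Suc_ex not_less)
    with i show ?thesis using assms by (simp add: join_simps)
  qed
qed

lemma sum_join:
  fixes h :: "'a \<Rightarrow> 'b \<Rightarrow> 'b \<Rightarrow> real"
  assumes "x n = y 0"
  shows "(\<Sum>i<n+m. h (join n \<xi> \<eta> i) (join n x y i) (join n x y (Suc i))) =
         (\<Sum>i<n. h (\<xi> i) (x i) (x (Suc i))) + (\<Sum>i<m. h (\<eta> i) (y i) (y (Suc i)))"
proof (induction m)
  case 0
  then show ?case using assms by (simp add: join_simps)
next
  case (Suc m)
  then show ?case by (simp add: join_simps)
qed

lemma interval_division_join:
  assumes "interval_division a c n x" "interval_division c b m y"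
  shows "interval_division a b (n + m) (join n x y)"
proof -
  have eq: "x n = y 0" using assms by (simp add: interval_division_def)
  have "join n x y 0 = a"
    using assms by (cases "n = 0") (auto simp: join_def interval_division_def)
  moreover have "join n x y (n + m) = b"
    using assms by (simp add: join_simps interval_division_def)
  moreover have "\<forall>i<n+m. join n x y i < join n x y (Suc i)"
    using all_join[of x n y "\<lambda>_ s t. s < t" x m y, OF eq] assms
    by (simp add: interval_division_def)
  ultimately show ?thesis by (simp add: interval_division_def)
qed

lemma interval_division_trivial: "interval_division a a 0 (\<lambda>_. a)"
  by (simp add: interval_division_def)

lemma interval_division_single: "a < b \<Longrightarrow> interval_division a b 1 (\<lambda>i. if i = 0 then a else b)"
  by (simp add: interval_division_def)

section \<open>Total variation\<close>

lemma variation_sumsI: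
  "interval_division a b n x \<Longrightarrow> (\<Sum>i<n. \<bar>u (x (Suc i)) - u (x i)\<bar>) \<in> variation_sums a b u"
  by (auto simp: variation_sums_def)

lemma abs_diff_in_variation_sums:
  assumes "a \<le> b"
  shows "\<bar>u b - u a\<bar> \<in> variation_sums a b u"
proof (cases "a = b")
  case True
  then show ?thesis
    using variation_sumsI[OF interval_division_trivial, of u a] by simp
next
  case False
  with assms have "a < b" by simp
  from variation_sumsI[OF interval_division_single[OF this], of u] show ?thesis by simp
qed

lemma variation_sums_join:
  assumes "s \<in> variation_sums a c u" "t \<in> variation_sums c b u"
  shows "s + t \<in> variation_sums a b u"
proof -
  obtain n x where x: "interval_division a c n x" "s = (\<Sum>i<n. \<bar>u (x (Suc i)) - u (x i)\<bar>)"
    using assms(1) by (auto simp: variation_sums_def)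
  obtain m y where y: "interval_division c b m y" "t = (\<Sum>i<m. \<bar>u (y (Suc i)) - u (y i)\<bar>)"
    using assms(2) by (auto simp: variation_sums_def)
  have "x n = y 0" using x(1) y(1) by (simp add: interval_division_def)
  from sum_join[of x n y "\<lambda>_ p q. \<bar>u q - u p\<bar>" x y, OF this]
  have "s + t = (\<Sum>i<n+m. \<bar>u (join n x y (Suc i)) - u (join n x y i)\<bar>)"
    using x(2) y(2) by simp
  then show ?thesis
    using interval_division_join[OF x(1) y(1)] unfolding variation_sums_def by blast
qed

lemma variation_sum_le_total_variation:
  assumes "bounded_variation a b u" "s \<in> variation_sums a b u"
  shows "s \<le> total_variation a b u"
  using assms unfolding total_variation_def bounded_variation_def by (intro cSup_upper)

lemma division_sum_le_total_variation:
  assumes "bounded_variation a b u" "interval_division a b n x"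
  shows "(\<Sum>i<n. \<bar>u (x (Suc i)) - u (x i)\<bar>) \<le> total_variation a b u"
  using assms by (intro variation_sum_le_total_variation variation_sumsI)

lemma abs_diff_le_total_variation:
  "bounded_variation a b u \<Longrightarrow> a \<le> b \<Longrightarrow> \<bar>u b - u a\<bar> \<le> total_variation a b u"
  by (intro variation_sum_le_total_variation abs_diff_in_variation_sums)

lemma total_variation_nonneg: "bounded_variation a b u \<Longrightarrow> a \<le> b \<Longrightarrow> 0 \<le> total_variation a b u"
  using abs_diff_le_total_variation[of a b u] by linarith

text \<open>The increments over \<open>[a, c]\<close> and \<open>[d, b]\<close> extend a variation sum over \<open>[c, d]\<close> to one over
  \<open>[a, b]\<close>.\<close>

lemma bounded_variation_subinterval:
  assumes "bounded_variation a b u" "a \<le> c" "c \<le> d" "d \<le> b"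
  shows "bounded_variation c d u"
  unfolding bounded_variation_def
proof (rule bdd_aboveI)
  fix s assume "s \<in> variation_sums c d u"
  then have "\<bar>u c - u a\<bar> + (s + \<bar>u b - u d\<bar>) \<in> variation_sums a b u"
    using assms(2-4) abs_diff_in_variation_sums[of a c u] abs_diff_in_variation_sums[of d b u]
    by (intro variation_sums_join)
  then show "s \<le> total_variation a b u"
    using variation_sum_le_total_variation[OF assms(1)] by fastforce
qed

lemma total_variation_superadditive:
  assumes "bounded_variation a b u" "a \<le> c" "c \<le> b"
  shows "total_variation a c u + total_variation c b u \<le> total_variation a b u"
proof -
  have ne: "variation_sums p q u \<noteq> {}" if "p \<le> q" for p q
    using abs_diff_in_variation_sums[OF that] by blast
  have "total_variation c b u \<le> total_variation a b u - s" if s: "s \<in> variation_sums a c u" for s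
    unfolding total_variation_def[of c]
  proof (rule cSup_least[OF ne[OF assms(3)]])
    fix t assume "t \<in> variation_sums c b u"
    from variation_sum_le_total_variation[OF assms(1) variation_sums_join[OF s this]]
    show "t \<le> total_variation a b u - s" by simp
  qed
  then have "s \<le> total_variation a b u - total_variation c b u" if "s \<in> variation_sums a c u" for s
    using that by force
  then have "total_variation a c u \<le> total_variation a b u - total_variation c b u"
    unfolding total_variation_def[of a c] by (intro cSup_least ne assms(2)) auto
  then show ?thesis by simp
qed

lemma sum_total_variation_le:
  assumes "interval_division a b n x" "bounded_variation a b u"
  shows "(\<Sum>i<n. total_variation (x i) (x (Suc i)) u) \<le> total_variation a b u"
  using assms
proof (induction n arbitrary: b)
  case 0
  then show ?case by (simp add: total_variation_nonneg interval_division_def)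
next
  case (Suc n)
  have b: "x (Suc n) = b" "a \<le> x n" "x n \<le> b"
    using Suc.prems(1) interval_division_points[OF Suc.prems(1), of n]
    by (auto simp: interval_division_def)
  then have "(\<Sum>i<n. total_variation (x i) (x (Suc i)) u) \<le> total_variation a (x n) u"
    by (intro Suc.IH interval_division_prefix[OF Suc.prems(1)]
        bounded_variation_subinterval[OF Suc.prems(2)]) auto
  with total_variation_superadditive[OF Suc.prems(2) b(2,3)] show ?case
    by (simp add: b(1))
qed

lemma total_variation_mono_on:
  assumes "mono_on {a..b} u" "a \<le> b"
  shows "bounded_variation a b u" "total_variation a b u = u b - u a"
proof -
  have "(\<Sum>i<n. \<bar>u (x (Suc i)) - u (x i)\<bar>) = u b - u a" if x: "interval_division a b n x" for n x
  proof -
    have "(\<Sum>i<n. \<bar>u (x (Suc i)) - u (x i)\<bar>) = (\<Sum>i<n. u (x (Suc i)) - u (x i))"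
    proof (rule sum.cong)
      fix i assume "i \<in> {..<n}"
      then have "u (x i) \<le> u (x (Suc i))"
        using interval_division_subinterval[OF x, of i] by (intro mono_onD[OF assms(1)]) auto
      then show "\<bar>u (x (Suc i)) - u (x i)\<bar> = u (x (Suc i)) - u (x i)" by simp
    qed simp
    also have "\<dots> = u (x n) - u (x 0)"
      by (rule sum_lessThan_telescope)
    finally show ?thesis using x by (simp add: interval_division_def)
  qed
  then have "variation_sums a b u \<subseteq> {u b - u a}"
    by (auto simp: variation_sums_def)
  moreover have "variation_sums a b u \<noteq> {}"
    using abs_diff_in_variation_sums[OF assms(2)] by blast
  ultimately have "variation_sums a b u = {u b - u a}" by blast
  then show "bounded_variation a b u" "total_variation a b u = u b - u a"
    by (simp_all add: bounded_variation_def total_variation_def)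
qed

section \<open>The Riemann--Stieltjes integral as a limit along a filter\<close>

type_synonym tagged_division = "nat \<times> (nat \<Rightarrow> real) \<times> (nat \<Rightarrow> real)"

definition fine_divisions :: "real \<Rightarrow> real \<Rightarrow> real \<Rightarrow> tagged_division set" where
  "fine_divisions a b \<delta> =
     {(n, x, \<xi>). interval_division a b n x \<and> (\<forall>i<n. x (Suc i) - x i < \<delta>) \<and>
        (\<forall>i<n. \<xi> i \<in> {x i..x (Suc i)})}"

definition mesh_filter :: "real \<Rightarrow> real \<Rightarrow> tagged_division filter" where
  "mesh_filter a b = (INF \<delta>\<in>{0<..}. principal (fine_divisions a b \<delta>))"

definition rs_sum :: "(real \<Rightarrow> real) \<Rightarrow> (real \<Rightarrow> real) \<Rightarrow> tagged_division \<Rightarrow> real" where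
  "rs_sum f u = (\<lambda>(n, x, \<xi>). \<Sum>i<n. f (\<xi> i) * (u (x (Suc i)) - u (x i)))"

lemma eventually_mesh_filter:
  "eventually P (mesh_filter a b) \<longleftrightarrow> (\<exists>\<delta>>0. \<forall>D\<in>fine_divisions a b \<delta>. P D)"
proof -
  have "fine_divisions a b (min p q) \<subseteq> fine_divisions a b p \<inter> fine_divisions a b q" for p q
    by (auto simp: fine_divisions_def)
  then have "\<exists>r\<in>{0<..}. principal (fine_divisions a b r)
      \<le> inf (principal (fine_divisions a b p)) (principal (fine_divisions a b q))"
    if "p \<in> {0<..}" "q \<in> {0<..}" for p q
    using that by (intro bexI[of _ "min p q"]) auto
  then show ?thesis
    unfolding mesh_filter_def
    by (subst eventually_INF_base) (auto simp: eventually_principal intro: exI[of _ "1::real"])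
qed

lemma eventually_mesh_filterI:
  assumes "0 < \<delta>" "\<And>D. D \<in> fine_divisions a b \<delta> \<Longrightarrow> P D"
  shows "eventually P (mesh_filter a b)"
  unfolding eventually_mesh_filter using assms by blast

lemma has_rs_integral_iff_tendsto:
  "has_rs_integral f u a b I \<longleftrightarrow> (rs_sum f u \<longlongrightarrow> I) (mesh_filter a b)"
  unfolding tendsto_iff eventually_mesh_filter has_rs_integral_def
  by (simp add: fine_divisions_def rs_sum_def dist_real_def Ball_def imp_conjL)

text \<open>Witnesses are the equidistant divisions.\<close>

lemma mesh_filter_neq_bot:
  assumes "a < b"
  shows "mesh_filter a b \<noteq> bot"
proof
  assume "mesh_filter a b = bot"
  then have "eventually (\<lambda>_. False) (mesh_filter a b)" by simp
  then obtain \<delta> where \<delta>: "\<delta> > 0" "fine_divisions a b \<delta> = {}"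
    unfolding eventually_mesh_filter by blast
  obtain k :: nat where k: "(b - a) / \<delta> < real k"
    using reals_Archimedean2 by blast
  define x where "x i = a + (b - a) * real i / real (Suc k)" for i
  have step: "x (Suc i) - x i = (b - a) / real (Suc k)" for i
  proof -
    have "x (Suc i) - x i = ((b - a) * real (Suc i) - (b - a) * real i) / real (Suc k)"
      unfolding x_def diff_divide_distrib by simp
    then show ?thesis by (simp add: algebra_simps)
  qed
  have "(b - a) / real (Suc k) < \<delta>"
    using k \<delta>(1) by (simp add: field_simps)
  moreover have "0 < (b - a) / real (Suc k)" using assms by simp
  ultimately have "x i < x (Suc i)" "x (Suc i) - x i < \<delta>" for i
    using step[of i] by linarith+
  moreover have "x 0 = a" "x (Suc k) = b" by (simp_all add: x_def)
  ultimately have "(Suc k, x, x) \<in> fine_divisions a b \<delta>"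
    by (auto simp: fine_divisions_def interval_division_def intro: less_imp_le)
  with \<delta>(2) show False by simp
qed

lemma has_rs_integral_unique:
  "a < b \<Longrightarrow> has_rs_integral f u a b I \<Longrightarrow> has_rs_integral f u a b J \<Longrightarrow> I = J"
  unfolding has_rs_integral_iff_tendsto by (rule tendsto_unique[OF mesh_filter_neq_bot])

lemma rs_integral_eqI: "a < b \<Longrightarrow> has_rs_integral f u a b I \<Longrightarrow> rs_integral f u a b = I"
  unfolding rs_integral_def by (rule the_equality) (auto intro: has_rs_integral_unique)

lemma rs_integrableD: "a < b \<Longrightarrow> rs_integrable f u a b \<Longrightarrow> has_rs_integral f u a b (rs_integral f u a b)"
  by (auto simp: rs_integrable_def rs_integral_eqI)

lemma has_rs_integral_add:
  assumes "has_rs_integral f u a b I" "has_rs_integral g u a b J"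
  shows "has_rs_integral (\<lambda>t. f t + g t) u a b (I + J)"
proof -
  have "rs_sum (\<lambda>t. f t + g t) u = (\<lambda>D. rs_sum f u D + rs_sum g u D)"
    by (auto simp: rs_sum_def sum.distrib distrib_right)
  then show ?thesis
    using tendsto_add assms unfolding has_rs_integral_iff_tendsto by auto
qed

lemma has_rs_integral_cmult:
  assumes "has_rs_integral f u a b I"
  shows "has_rs_integral (\<lambda>t. k * f t) u a b (k * I)"
proof -
  have "rs_sum (\<lambda>t. k * f t) u = (\<lambda>D. k * rs_sum f u D)"
    by (auto simp: rs_sum_def sum_distrib_left mult.assoc)
  then show ?thesis
    using tendsto_mult_left assms unfolding has_rs_integral_iff_tendsto by auto
qed

lemma has_rs_integral_const: "has_rs_integral (\<lambda>_. k) u a b (k * (u b - u a))"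
proof -
  have "rs_sum (\<lambda>_. k) u D = k * (u b - u a)" if "D \<in> fine_divisions a b 1" for D
    using that sum_lessThan_telescope[of "\<lambda>i. u (fst (snd D) i)" "fst D"]
    by (auto simp: rs_sum_def fine_divisions_def interval_division_def simp flip: sum_distrib_left)
  then show ?thesis
    unfolding has_rs_integral_iff_tendsto
    by (intro tendsto_eventually eventually_mesh_filterI[of 1]) auto
qed

text \<open>Pairs of fine tagged divisions of two adjacent intervals are carried to fine tagged divisions
  of the union by concatenation, and the Riemann sums add up.\<close>

lemma has_rs_integral_combine:
  assumes I: "has_rs_integral f u a b I"
    and J: "has_rs_integral f u a c J" and K: "has_rs_integral f u c b K"
    and "a < c" "c < b"
  shows "I = J + K"
proof -
  define cat :: "tagged_division \<times> tagged_division \<Rightarrow> tagged_division" where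
    "cat = (\<lambda>((n, x, \<xi>), (m, y, \<eta>)). (n + m, join n x y, join n \<xi> \<eta>))"
  have fine: "cat (D, E) \<in> fine_divisions a b \<delta>" and
    sum: "rs_sum f u (cat (D, E)) = rs_sum f u D + rs_sum f u E"
    if "D \<in> fine_divisions a c \<delta>" "E \<in> fine_divisions c b \<delta>" for D E \<delta>
  proof -
    obtain n x \<xi> m y \<eta> where DE: "D = (n, x, \<xi>)" "E = (m, y, \<eta>)" by (metis prod_cases3)
    with that have eq: "x n = y 0" by (auto simp: fine_divisions_def interval_division_def)
    have "\<forall>i<n+m. join n x y (Suc i) - join n x y i < \<delta> \<and>
        join n \<xi> \<eta> i \<in> {join n x y i..join n x y (Suc i)}"
      using that DE
      by (intro all_join[of x n y "\<lambda>z p q. q - p < \<delta> \<and> z \<in> {p..q}", OF eq])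
        (auto simp: fine_divisions_def)
    with that DE show "cat (D, E) \<in> fine_divisions a b \<delta>"
      by (auto simp: fine_divisions_def cat_def intro: interval_division_join)
    show "rs_sum f u (cat (D, E)) = rs_sum f u D + rs_sum f u E"
      using sum_join[of x n y "\<lambda>z p q. f z * (u q - u p)", OF eq]
      by (simp add: DE cat_def rs_sum_def)
  qed
  let ?F = "mesh_filter a c \<times>\<^sub>F mesh_filter c b"
  have ne: "?F \<noteq> bot"
    using assms(4,5) by (simp add: prod_filter_eq_bot mesh_filter_neq_bot)
  have "filterlim cat (mesh_filter a b) ?F"
    unfolding filterlim_iff eventually_mesh_filter[of _ a b]
  proof (intro allI impI, elim exE conjE)
    fix P \<delta> assume \<delta>: "\<delta> > 0" "\<forall>D\<in>fine_divisions a b \<delta>. P D"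
    then show "\<forall>\<^sub>F p in ?F. P (cat p)"
      unfolding eventually_prod_filter
      by (intro exI[of _ "\<lambda>D. D \<in> fine_divisions a c \<delta>"] exI[of _ "\<lambda>E. E \<in> fine_divisions c b \<delta>"])
        (auto simp: fine intro!: eventually_mesh_filterI[of \<delta>])
  qed
  then have "((\<lambda>p. rs_sum f u (cat p)) \<longlongrightarrow> I) ?F"
    using I unfolding has_rs_integral_iff_tendsto by (rule filterlim_compose[rotated])
  moreover have "\<forall>\<^sub>F p in ?F. rs_sum f u (cat p) = rs_sum f u (fst p) + rs_sum f u (snd p)"
    unfolding eventually_prod_filter
    by (intro exI[of _ "\<lambda>D. D \<in> fine_divisions a c 1"] exI[of _ "\<lambda>E. E \<in> fine_divisions c b 1"])
      (auto simp: sum intro!: eventually_mesh_filterI[of 1])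
  ultimately have "((\<lambda>p. rs_sum f u (fst p) + rs_sum f u (snd p)) \<longlongrightarrow> I) ?F"
    by (simp add: tendsto_cong)
  moreover have "((\<lambda>p. rs_sum f u (fst p) + rs_sum f u (snd p)) \<longlongrightarrow> J + K) ?F"
    using J K unfolding has_rs_integral_iff_tendsto
    by (intro tendsto_add) (erule filterlim_compose, intro filterlim_fst filterlim_snd)+
  ultimately show ?thesis by (rule tendsto_unique[OF ne])
qed

lemma has_rs_integral_abs_le:
  assumes "has_rs_integral h u a b J" "a < b" "bounded_variation a b u"
    and h: "\<And>t. t \<in> {a..b} \<Longrightarrow> \<bar>h t\<bar> \<le> K"
  shows "\<bar>J\<bar> \<le> K * total_variation a b u"
proof (rule tendsto_upperbound[OF _ _ mesh_filter_neq_bot[OF assms(2)]])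
  show "((\<lambda>D. \<bar>rs_sum h u D\<bar>) \<longlongrightarrow> \<bar>J\<bar>) (mesh_filter a b)"
    using assms(1) unfolding has_rs_integral_iff_tendsto by (rule tendsto_rabs)
  have "0 \<le> K" using h[of a] assms(2) by force
  have "\<bar>rs_sum h u D\<bar> \<le> K * total_variation a b u" if D: "D \<in> fine_divisions a b 1" for D
  proof -
    obtain n x \<xi> where [simp]: "D = (n, x, \<xi>)" by (metis prod_cases3)
    have x: "interval_division a b n x" and \<xi>: "\<forall>i<n. \<xi> i \<in> {x i..x (Suc i)}"
      using D by (auto simp: fine_divisions_def)
    have "\<bar>h (\<xi> i) * (u (x (Suc i)) - u (x i))\<bar> \<le> K * \<bar>u (x (Suc i)) - u (x i)\<bar>" if "i < n" for i
      using h[of "\<xi> i"] \<xi> interval_division_subinterval(2)[OF x that] that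
      by (auto simp: abs_mult intro!: mult_right_mono)
    then have "\<bar>rs_sum h u D\<bar> \<le> (\<Sum>i<n. K * \<bar>u (x (Suc i)) - u (x i)\<bar>)"
      unfolding rs_sum_def by (auto intro!: order_trans[OF sum_abs] sum_mono)
    also have "\<dots> \<le> K * total_variation a b u"
      unfolding sum_distrib_left[symmetric]
      by (intro mult_left_mono division_sum_le_total_variation assms x \<open>0 \<le> K\<close>)
    finally show ?thesis .
  qed
  then show "\<forall>\<^sub>F D in mesh_filter a b. \<bar>rs_sum h u D\<bar> \<le> K * total_variation a b u"
    by (intro eventually_mesh_filterI[of 1]) auto
qed

section \<open>Existence of the integral of a continuous function\<close>

text \<open>
  The tags only need to be near their intervals, which may be degenerate. This makes the statement
  stable under moving the left endpoint of the first interval to the right, which is what the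
  induction on the total number of intervals does.
\<close>

lemma riemann_sums_close:
  fixes u :: "real \<Rightarrow> real" and \<xi> \<eta> :: "nat \<Rightarrow> real"
  assumes unif: "\<And>s t. s \<in> A \<Longrightarrow> t \<in> A \<Longrightarrow> \<bar>s - t\<bar> < 2 * \<delta> \<Longrightarrow> \<bar>f s - f t\<bar> \<le> \<epsilon>"
    and "0 \<le> \<epsilon>"
    and "x 0 = a" "x n = b" "\<forall>i<n. x i \<le> x (Suc i)"
    and "\<forall>i<n. \<xi> i \<in> A \<and> \<bar>\<xi> i - x i\<bar> < \<delta> \<and> \<bar>\<xi> i - x (Suc i)\<bar> < \<delta>"
    and "y 0 = a" "y m = b" "\<forall>i<m. y i \<le> y (Suc i)"
    and "\<forall>i<m. \<eta> i \<in> A \<and> \<bar>\<eta> i - y i\<bar> < \<delta> \<and> \<bar>\<eta> i - y (Suc i)\<bar> < \<delta>"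
    and "bounded_variation a b u"
  shows "\<bar>rs_sum f u (n, x, \<xi>) - rs_sum f u (m, y, \<eta>)\<bar> \<le> \<epsilon> * total_variation a b u"
proof -
  define near where "near a n x \<xi> \<longleftrightarrow> x 0 = a \<and> x n = b \<and> (\<forall>i<n. x i \<le> x (Suc i)) \<and>
      (\<forall>i<n. \<xi> i \<in> A \<and> \<bar>\<xi> i - x i\<bar> < \<delta> \<and> \<bar>\<xi> i - x (Suc i)\<bar> < \<delta>)"
    for a n and x \<xi> :: "nat \<Rightarrow> real"
  have degenerate: "rs_sum f u (n, x, \<xi>) = 0" if "near b n x \<xi>" for n x \<xi>
  proof -
    have "x i = b" if "i \<le> n" for i
      using \<open>near b n x \<xi>\<close> that division_mono[of n x 0 i] division_mono[of n x i n]
      by (fastforce simp: near_def)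
    then show ?thesis by (simp add: rs_sum_def)
  qed
  have "\<bar>rs_sum f u (n, x, \<xi>) - rs_sum f u (m, y, \<eta>)\<bar> \<le> \<epsilon> * total_variation a b u"
    if "near a n x \<xi>" "near a m y \<eta>" "bounded_variation a b u" for n x \<xi> m y \<eta>
    using that
  proof (induction "n + m" arbitrary: a n x \<xi> m y \<eta> rule: less_induct)
    case less
    have shorter: "\<bar>rs_sum f u (Suc n, x, \<xi>) - rs_sum f u (Suc m, y, \<eta>)\<bar>
        \<le> \<epsilon> * total_variation a b u"
      if IH: "\<And>y \<eta>. near (x 1) (Suc m) y \<eta> \<Longrightarrow> bounded_variation (x 1) b u \<Longrightarrow>
           \<bar>rs_sum f u (n, x \<circ> Suc, \<xi> \<circ> Suc) - rs_sum f u (Suc m, y, \<eta>)\<bar>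
             \<le> \<epsilon> * total_variation (x 1) b u"
        and x: "near a (Suc n) x \<xi>" and y: "near a (Suc m) y \<eta>" and le: "x 1 \<le> y 1"
      for n x \<xi> m y \<eta>
    proof -
      \<comment> \<open>The first interval of \<open>x\<close> is dropped and cut off the first interval of \<open>y\<close>, whose tag \<open>\<eta> 0\<close>
        may now lie outside.\<close>
      let ?y = "y(0 := x 1)"
      have a: "x 0 = a" "y 0 = a" and ax: "a \<le> x 1" "x 1 \<le> b"
        using x y division_mono[of "Suc n" x 1 "Suc n"] by (auto simp: near_def)
      have "near (x 1) (Suc m) ?y \<eta>"
        using y ax a le by (auto simp: near_def)
      then have "\<bar>rs_sum f u (n, x \<circ> Suc, \<xi> \<circ> Suc) - rs_sum f u (Suc m, ?y, \<eta>)\<bar>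
          \<le> \<epsilon> * total_variation (x 1) b u"
        using bounded_variation_subinterval[OF less.prems(3) ax] by (intro IH) auto
      moreover have "rs_sum f u (Suc n, x, \<xi>) = f (\<xi> 0) * (u (x 1) - u a)
          + rs_sum f u (n, x \<circ> Suc, \<xi> \<circ> Suc)"
        unfolding rs_sum_def prod.case by (subst sum.lessThan_Suc_shift) (simp add: a)
      moreover have "rs_sum f u (Suc m, y, \<eta>) = f (\<eta> 0) * (u (x 1) - u a)
          + rs_sum f u (Suc m, ?y, \<eta>)"
        unfolding rs_sum_def prod.case
        by (subst (1 2) sum.lessThan_Suc_shift) (simp add: a algebra_simps)
      moreover have "\<bar>(f (\<xi> 0) - f (\<eta> 0)) * (u (x 1) - u a)\<bar> \<le> \<epsilon> * total_variation a (x 1) u"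
      proof -
        have "\<bar>f (\<xi> 0) - f (\<eta> 0)\<bar> \<le> \<epsilon>"
        proof (rule unif)
          show "\<xi> 0 \<in> A" "\<eta> 0 \<in> A" using x y by (auto simp: near_def)
          have "\<bar>\<xi> 0 - a\<bar> < \<delta>" "\<bar>\<eta> 0 - a\<bar> < \<delta>" using x y by (auto simp: near_def)
          then show "\<bar>\<xi> 0 - \<eta> 0\<bar> < 2 * \<delta>" by linarith
        qed
        moreover have "\<bar>u (x 1) - u a\<bar> \<le> total_variation a (x 1) u"
          using bounded_variation_subinterval[OF less.prems(3), of a "x 1"] ax
          by (intro abs_diff_le_total_variation) auto
        ultimately show ?thesis
          using \<open>0 \<le> \<epsilon>\<close> unfolding abs_mult by (intro mult_mono) auto
      qed
      moreover have "\<epsilon> * (total_variation a (x 1) u + total_variation (x 1) b u)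
          \<le> \<epsilon> * total_variation a b u"
        using total_variation_superadditive[OF less.prems(3) ax] \<open>0 \<le> \<epsilon>\<close> by (rule mult_left_mono)
      ultimately show ?thesis
        unfolding left_diff_distrib distrib_left by linarith
    qed
    have shift: "near (x 1) n (x \<circ> Suc) (\<xi> \<circ> Suc)" if "near a (Suc n) x \<xi>" for a n x \<xi>
      using that by (auto simp: near_def)
    have ab: "a \<le> b"
      using less.prems(1) division_mono[of n x 0 n] by (auto simp: near_def)
    show ?case
    proof (cases "n = 0 \<or> m = 0")
      case True
      then have "a = b" using less.prems(1,2) by (auto simp: near_def)
      then show ?thesis
        using less.prems total_variation_nonneg[OF less.prems(3)] \<open>0 \<le> \<epsilon>\<close>
        by (simp add: degenerate)
    next
      case False
      then obtain n' m' where nm: "n = Suc n'" "m = Suc m'" by (metis not0_implies_Suc)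
      note prems = less.prems(1,2)[unfolded nm]
      show ?thesis
      proof (cases "x 1 \<le> y 1")
        case True
        then show ?thesis unfolding nm
          by (intro shorter less.hyps shift[OF prems(1)] prems) (auto simp: nm)
      next
        case False
        then have "\<bar>rs_sum f u (m, y, \<eta>) - rs_sum f u (n, x, \<xi>)\<bar> \<le> \<epsilon> * total_variation a b u"
          unfolding nm by (intro shorter less.hyps shift[OF prems(2)] prems) (auto simp: nm)
        then show ?thesis by (simp add: abs_minus_commute)
      qed
    qed
  qed
  then show ?thesis
    using assms(3-) by (simp add: near_def)
qed

lemma rs_integrable_continuous:
  assumes "continuous_on {a..b} f" "bounded_variation a b u" "a < b"
  shows "rs_integrable f u a b"
proof -
  let ?V = "total_variation a b u"
  have V: "0 \<le> ?V" using assms by (simp add: total_variation_nonneg)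
  have "cauchy_filter (filtermap (rs_sum f u) (mesh_filter a b))"
    unfolding cauchy_filter_metric_filtermap
  proof (intro allI impI)
    fix e :: real assume e: "e > 0"
    define \<epsilon> where "\<epsilon> = e / (?V + 1)"
    have \<epsilon>: "\<epsilon> > 0" "\<epsilon> * ?V < e" using e V by (auto simp: \<epsilon>_def field_simps)
    have "uniformly_continuous_on {a..b} f"
      using assms(1) by (intro compact_uniformly_continuous) auto
    then obtain d where d: "d > 0"
      "\<And>s t. s \<in> {a..b} \<Longrightarrow> t \<in> {a..b} \<Longrightarrow> \<bar>s - t\<bar> < d \<Longrightarrow> \<bar>f s - f t\<bar> < \<epsilon>"
      using \<epsilon>(1) unfolding uniformly_continuous_on_def dist_real_def by metis
    let ?P = "\<lambda>D. D \<in> fine_divisions a b (d / 2)"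
    have "dist (rs_sum f u D) (rs_sum f u E) < e" if "?P D" "?P E" for D E
    proof -
      obtain n x \<xi> m y \<eta> where DE: "D = (n, x, \<xi>)" "E = (m, y, \<eta>)" by (metis prod_cases3)
      have tags: "\<forall>i<n. \<xi> i \<in> {a..b} \<and> \<bar>\<xi> i - x i\<bar> < d / 2 \<and> \<bar>\<xi> i - x (Suc i)\<bar> < d / 2"
        if "(n, x, \<xi>) \<in> fine_divisions a b (d / 2)" for n x \<xi>
      proof (intro allI impI)
        fix i assume i: "i < n"
        have "interval_division a b n x" "x (Suc i) - x i < d / 2" "\<xi> i \<in> {x i..x (Suc i)}"
          using that i by (auto simp: fine_divisions_def)
        with interval_division_subinterval(2)[OF this(1) i]
        show "\<xi> i \<in> {a..b} \<and> \<bar>\<xi> i - x i\<bar> < d / 2 \<and> \<bar>\<xi> i - x (Suc i)\<bar> < d / 2"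
          by auto
      qed
      have div: "x 0 = a \<and> x n = b \<and> (\<forall>i<n. x i \<le> x (Suc i))"
        if "(n, x, \<xi>) \<in> fine_divisions a b (d / 2)" for n x \<xi>
        using that by (auto simp: fine_divisions_def interval_division_def intro: less_imp_le)
      have "\<bar>rs_sum f u D - rs_sum f u E\<bar> \<le> \<epsilon> * ?V"
        unfolding DE
        by (rule riemann_sums_close[where A = "{a..b}" and \<delta> = "d / 2"])
          (use that[unfolded DE] tags div d(2) \<epsilon>(1) assms(2) in \<open>auto intro: less_imp_le\<close>)
      with \<epsilon>(2) show ?thesis by (simp add: dist_real_def)
    qed
    moreover have "eventually ?P (mesh_filter a b)"
      using d(1) by (intro eventually_mesh_filterI[of "d / 2"]) auto
    ultimately show "\<exists>P. eventually P (mesh_filter a b) \<and>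
        (\<forall>D E. P D \<and> P E \<longrightarrow> dist (rs_sum f u D) (rs_sum f u E) < e)"
      by blast
  qed
  from cauchy_filter_complete_converges[OF this complete_UNIV]
  obtain I where "filtermap (rs_sum f u) (mesh_filter a b) \<le> nhds I"
    using mesh_filter_neq_bot[OF assms(3)] by (auto simp: filtermap_bot_iff)
  then show ?thesis
    unfolding rs_integrable_def has_rs_integral_iff_tendsto filterlim_def by blast
qed

lemma rs_integral_sum_division:
  assumes "interval_division a b n x" "bounded_variation a b u" "continuous_on {a..b} f" "0 < n"
  shows "rs_integral f u a b = (\<Sum>i<n. rs_integral f u (x i) (x (Suc i)))"
  using assms
proof (induction n arbitrary: b)
  case 0
  then show ?case by simp
next
  case (Suc n)
  have b: "x (Suc n) = b" "x 0 = a" "a \<le> x n" "x n < b"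
    using Suc.prems(1) interval_division_points[OF Suc.prems(1), of n]
    by (auto simp: interval_division_def)
  show ?case
  proof (cases "n = 0")
    case True
    then show ?thesis using b by simp
  next
    case False
    then obtain k where "n = Suc k" by (cases n) auto
    then have "a < x n"
      using interval_division_points(1)[OF Suc.prems(1), of k]
        interval_division_subinterval(1)[OF Suc.prems(1), of k] by simp
    have int: "has_rs_integral f u c d (rs_integral f u c d)"
      if "a \<le> c" "c < d" "d \<le> b" for c d
      using that
      by (intro rs_integrableD rs_integrable_continuous continuous_on_subset[OF Suc.prems(3)]
          bounded_variation_subinterval[OF Suc.prems(2)]) auto
    have "rs_integral f u a b = rs_integral f u a (x n) + rs_integral f u (x n) b"
      using b \<open>a < x n\<close> by (intro has_rs_integral_combine[of f u a b _ "x n"] int) auto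
    moreover have "rs_integral f u a (x n) = (\<Sum>i<n. rs_integral f u (x i) (x (Suc i)))"
      using False b
      by (intro Suc.IH interval_division_prefix[OF Suc.prems(1)]
          bounded_variation_subinterval[OF Suc.prems(2)] continuous_on_subset[OF Suc.prems(3)]) auto
    ultimately show ?thesis by (simp add: b(1))
  qed
qed

section \<open>The error bound\<close>

text \<open>The error is the integral of \<open>(f - k) (g - \<mu>)\<close> for every constant \<open>k\<close>; the midpoint of the range of
  \<open>f\<close> minimises the sup norm of \<open>f - k\<close> and is the source of the factor \<open>1/2\<close>.\<close>

lemma product_quadrature_error_interval:
  assumes "c < d" "continuous_on {c..d} f" "continuous_on {c..d} g" "bounded_variation c d u"
    and "u d \<noteq> u c"
    and osc: "(SUP t\<in>{c..d}. f t) - (INF t\<in>{c..d}. f t) \<le> v"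
    and dev: "sup_norm_on c d (\<lambda>t. g t - rs_mean g u c d) \<le> D"
  shows "\<bar>rs_integral (\<lambda>t. f t * g t) u c d
      - 1 / (u d - u c) * rs_integral f u c d * rs_integral g u c d\<bar>
    \<le> 1/2 * v * D * total_variation c d u"
proof -
  define \<mu> where "\<mu> = rs_mean g u c d"
  define M where "M = (SUP t\<in>{c..d}. f t)"
  define m where "m = (INF t\<in>{c..d}. f t)"
  define k where "k = (M + m) / 2"
  define J where "J = rs_integral (\<lambda>t. f t * g t) u c d
    + ((-\<mu>) * rs_integral f u c d + ((-k) * rs_integral g u c d + k * \<mu> * (u d - u c)))"
  have int: "has_rs_integral h u c d (rs_integral h u c d)" if "continuous_on {c..d} h" for h
    using assms that by (intro rs_integrableD rs_integrable_continuous)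
  have "has_rs_integral (\<lambda>t. f t * g t + ((-\<mu>) * f t + ((-k) * g t + k * \<mu>))) u c d J"
    unfolding J_def using assms
    by (intro has_rs_integral_add has_rs_integral_cmult has_rs_integral_const int continuous_on_mult)
  then have J: "has_rs_integral (\<lambda>t. (f t - k) * (g t - \<mu>)) u c d J"
    by (simp add: algebra_simps)
  have "\<bar>J\<bar> \<le> (v / 2 * D) * total_variation c d u"
  proof (rule has_rs_integral_abs_le[OF J assms(1,4)])
    fix t assume t: "t \<in> {c..d}"
    have bdd: "bounded (h ` {c..d})" if "continuous_on {c..d} h" for h :: "real \<Rightarrow> real"
      using that by (intro compact_imp_bounded compact_continuous_image) auto
    have "f t \<le> M" "m \<le> f t"
      unfolding M_def m_def using bdd[OF assms(2)] t
      by (auto intro: cSUP_upper cINF_lower bounded_imp_bdd_above bounded_imp_bdd_below)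
    then have "\<bar>f t - k\<bar> \<le> v / 2"
      using osc unfolding k_def M_def[symmetric] m_def[symmetric] by (simp add: abs_le_iff field_simps)
    moreover have "\<bar>g t - \<mu>\<bar> \<le> D"
    proof -
      have "continuous_on {c..d} (\<lambda>t. \<bar>g t - \<mu>\<bar>)"
        using assms(3) by (intro continuous_intros)
      from bounded_imp_bdd_above[OF bdd[OF this]]
      have "\<bar>g t - \<mu>\<bar> \<le> sup_norm_on c d (\<lambda>t. g t - \<mu>)"
        unfolding sup_norm_on_def using t by (intro cSUP_upper)
      with dev show ?thesis by (simp add: \<mu>_def)
    qed
    ultimately show "\<bar>(f t - k) * (g t - \<mu>)\<bar> \<le> v / 2 * D"
      unfolding abs_mult by (rule mult_mono') auto
  qed
  moreover have "J = rs_integral (\<lambda>t. f t * g t) u c d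
      - 1 / (u d - u c) * rs_integral f u c d * rs_integral g u c d"
    using assms(5) unfolding J_def \<mu>_def rs_mean_def by (simp add: field_simps)
  ultimately show ?thesis by simp
qed

lemma product_quadrature_error:
  assumes "a < b" and adm: "admissible a b f g u n x"
  shows "\<bar>rs_integral (\<lambda>t. f t * g t) u a b - product_quadrature f g u n x\<bar>
    \<le> 1/2 * max_oscillation f n x * max_mean_deviation g u n x * total_variation a b u"
proof -
  note adm = adm[unfolded admissible_def]
  then have x: "interval_division a b n x" and bv: "bounded_variation a b u" by auto
  have n: "0 < n" using interval_division_pos[OF x assms(1)] .
  let ?v = "max_oscillation f n x" and ?D = "max_mean_deviation g u n x"
  let ?V = "\<lambda>i. total_variation (x i) (x (Suc i)) u"
  let ?E = "\<lambda>i. rs_integral (\<lambda>t. f t * g t) u (x i) (x (Suc i)) - 1 / (u (x (Suc i)) - u (x i))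
        * rs_integral f u (x i) (x (Suc i)) * rs_integral g u (x i) (x (Suc i))"
  have E: "\<bar>?E i\<bar> \<le> 1/2 * ?v * ?D * ?V i" if i: "i < n" for i
  proof (rule product_quadrature_error_interval)
    note sub = interval_division_subinterval[OF x i]
    show "x i < x (Suc i)" by (rule sub)
    show "continuous_on {x i..x (Suc i)} f" "continuous_on {x i..x (Suc i)} g"
      using adm sub(2) by (auto intro: continuous_on_subset)
    show "bounded_variation (x i) (x (Suc i)) u"
      using sub by (intro bounded_variation_subinterval[OF bv]) auto
    show "u (x (Suc i)) \<noteq> u (x i)" using adm i by blast
  qed (use i in \<open>auto simp: max_oscillation_def max_mean_deviation_def intro!: Max_ge\<close>)
  have "rs_integral (\<lambda>t. f t * g t) u a b - product_quadrature f g u n x = (\<Sum>i<n. ?E i)"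
    using rs_integral_sum_division[OF x bv continuous_on_mult n, of f g] adm
    by (simp add: product_quadrature_def sum_subtractf)
  then have "\<bar>rs_integral (\<lambda>t. f t * g t) u a b - product_quadrature f g u n x\<bar>
      \<le> (\<Sum>i<n. \<bar>?E i\<bar>)"
    by (simp only: sum_abs)
  also have "\<dots> \<le> (\<Sum>i<n. 1/2 * ?v * ?D * ?V i)"
    using E by (intro sum_mono) auto
  also have "\<dots> = 1/2 * ?v * ?D * (\<Sum>i<n. ?V i)"
    by (simp only: sum_distrib_left)
  also have "\<dots> \<le> 1/2 * ?v * ?D * total_variation a b u"
  proof (rule mult_left_mono[OF sum_total_variation_le[OF x bv]])
    \<comment> \<open>The sign of the coefficient is read off from the first interval.\<close>
    have ax: "x 0 = a" "a < x 1" "{a..x 1} \<subseteq> {a..b}"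
      using interval_division_subinterval[OF x n] x by (auto simp: interval_division_def)
    have bdd: "bounded (h ` {a..x 1})" if "continuous_on {a..x 1} h" for h :: "real \<Rightarrow> real"
      using that by (intro compact_imp_bounded compact_continuous_image) auto
    have cont: "continuous_on {a..x 1} f" "continuous_on {a..x 1} g"
      using adm ax(3) by (auto intro: continuous_on_subset)
    have "(INF t\<in>{a..x 1}. f t) \<le> f a" "f a \<le> (SUP t\<in>{a..x 1}. f t)"
      using bdd[OF cont(1)] ax(2)
      by (auto intro!: cINF_lower cSUP_upper bounded_imp_bdd_above bounded_imp_bdd_below)
    moreover have "(SUP t\<in>{x 0..x (Suc 0)}. f t) - (INF t\<in>{x 0..x (Suc 0)}. f t) \<le> ?v"
      unfolding max_oscillation_def using n by (intro Max_ge) auto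
    ultimately have "0 \<le> ?v" by (simp add: ax(1))
    moreover have "0 \<le> ?D"
    proof -
      have "continuous_on {a..x 1} (\<lambda>t. \<bar>g t - rs_mean g u a (x 1)\<bar>)"
        using cont(2) by (intro continuous_intros)
      from bounded_imp_bdd_above[OF bdd[OF this]]
      have "\<bar>g a - rs_mean g u a (x 1)\<bar> \<le> sup_norm_on a (x 1) (\<lambda>t. g t - rs_mean g u a (x 1))"
        unfolding sup_norm_on_def using ax(2) by (intro cSUP_upper) auto
      moreover have "sup_norm_on (x 0) (x (Suc 0)) (\<lambda>t. g t - rs_mean g u (x 0) (x (Suc 0))) \<le> ?D"
        unfolding max_mean_deviation_def using n by (intro Max_ge) auto
      ultimately show ?thesis by (simp add: ax(1))
    qed
    ultimately show "0 \<le> 1/2 * ?v * ?D" by simp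
  qed
  finally show ?thesis .
qed

section \<open>Sharpness of the constant\<close>

definition endpoint_jumps :: "real \<Rightarrow> real \<Rightarrow> real \<Rightarrow> real" where
  "endpoint_jumps a b t = (if t \<le> a then 0 else if t < b then 1 else 2)"

text \<open>Once the division has at least two intervals, only the first and the last increment of the
  integrator are nonzero, and their tags tend to the endpoints.\<close>

lemma has_rs_integral_endpoint_jumps:
  assumes "continuous_on {a..b} h" "a < b"
  shows "has_rs_integral h (endpoint_jumps a b) a b (h a + h b)"
  unfolding has_rs_integral_iff_tendsto tendsto_iff
proof (intro allI impI)
  fix e :: real assume "e > 0"
  let ?u = "endpoint_jumps a b"
  obtain d1 where d1: "d1 > 0" "\<And>t. t \<in> {a..b} \<Longrightarrow> \<bar>t - a\<bar> < d1 \<Longrightarrow> \<bar>h t - h a\<bar> < e / 2"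
    using assms \<open>e > 0\<close> unfolding continuous_on_iff dist_real_def
    by (metis atLeastAtMost_iff half_gt_zero less_eq_real_def)
  obtain d2 where d2: "d2 > 0" "\<And>t. t \<in> {a..b} \<Longrightarrow> \<bar>t - b\<bar> < d2 \<Longrightarrow> \<bar>h t - h b\<bar> < e / 2"
    using assms \<open>e > 0\<close> unfolding continuous_on_iff dist_real_def
    by (metis atLeastAtMost_iff half_gt_zero less_eq_real_def)
  define \<delta> where "\<delta> = min (b - a) (min d1 d2)"
  show "\<forall>\<^sub>F D in mesh_filter a b. dist (rs_sum h ?u D) (h a + h b) < e"
  proof (rule eventually_mesh_filterI[of \<delta>])
    show "0 < \<delta>" using d1(1) d2(1) assms(2) by (simp add: \<delta>_def)
    fix D assume D: "D \<in> fine_divisions a b \<delta>"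
    obtain n x \<xi> where D_eq: "D = (n, x, \<xi>)" by (metis prod_cases3)
    have x: "interval_division a b n x" and mesh: "\<And>i. i < n \<Longrightarrow> x (Suc i) - x i < \<delta>"
      and \<xi>: "\<And>i. i < n \<Longrightarrow> \<xi> i \<in> {x i..x (Suc i)}"
      using D by (auto simp: D_eq fine_divisions_def)
    have x0: "x 0 = a" and xn: "x n = b" and lt: "\<And>i. i < n \<Longrightarrow> x i < x (Suc i)"
      using x by (auto simp: interval_division_def)
    have "n \<noteq> 0" using interval_division_pos[OF x assms(2)] by simp
    moreover have "n \<noteq> 1"
      using mesh[of 0] x0 xn by (auto simp: \<delta>_def)
    ultimately obtain k where n: "n = Suc (Suc k)"
      by (metis One_nat_def not0_implies_Suc)
    have inner: "a < x i" "x i < b" if "0 < i" "i < n" for i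
      using division_mono[OF interval_division_weak[OF x], of 1 i]
        division_mono[OF interval_division_weak[OF x], of i "Suc k"]
        lt[of 0] lt[of "Suc k"] that x0 xn n by auto
    have u: "?u (x i) = (if i = 0 then 0 else if i < n then 1 else 2)" if "i \<le> n" for i
      using inner[of i] that x0 xn assms(2) n
      by (cases "i = 0"; cases "i = n") (auto simp: endpoint_jumps_def)
    have "rs_sum h ?u D = h (\<xi> 0) + h (\<xi> (Suc k))"
      unfolding D_eq rs_sum_def prod.case n
      by (subst sum.lessThan_Suc, subst sum.lessThan_Suc_shift) (simp add: u n)
    moreover have "\<bar>h (\<xi> 0) - h a\<bar> < e / 2"
      using \<xi>[of 0] mesh[of 0] interval_division_subinterval(2)[OF x, of 0] n x0
      by (intro d1(2)) (auto simp: \<delta>_def)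
    moreover have "\<bar>h (\<xi> (Suc k)) - h b\<bar> < e / 2"
      using \<xi>[of "Suc k"] mesh[of "Suc k"] interval_division_subinterval(2)[OF x, of "Suc k"] n xn
      by (intro d2(2)) (auto simp: \<delta>_def)
    ultimately show "dist (rs_sum h ?u D) (h a + h b) < e"
      unfolding dist_real_def by linarith
  qed
qed

text \<open>Here \<open>\<integral> f du = f a + f b = 0\<close>, so the quadrature on the single interval \<open>[a, b]\<close> gives 0, whereas
  \<open>\<integral> f\<^sup>2 du = 2\<close>. The error bound with constant \<open>1/2\<close> is then an equality.\<close>

lemma product_quadrature_error_attained:
  assumes "a < b"
  obtains f g u n x where "admissible a b f g u n x"
    "rs_integral (\<lambda>t. f t * g t) u a b - product_quadrature f g u n x = 2"
    "max_oscillation f n x = 2" "max_mean_deviation g u n x = 1" "total_variation a b u = 2"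
proof -
  define f :: "real \<Rightarrow> real" where "f t = (2 * t - a - b) / (b - a)" for t
  define x where "x i = (if i = 0 then a else b)" for i :: nat
  let ?u = "endpoint_jumps a b"
  have ends: "f a = -1" "f b = 1"
    using assms by (simp_all add: f_def divide_eq_eq)
  have range: "-1 \<le> f t" "f t \<le> 1" if "t \<in> {a..b}" for t
    using that assms by (simp_all add: f_def field_simps)
  have cont: "continuous_on {a..b} f"
    unfolding f_def by (intro continuous_intros) (use assms in auto)
  have u: "?u a = 0" "?u b = 2" using assms by (auto simp: endpoint_jumps_def)
  have "mono_on {a..b} ?u" by (auto simp: endpoint_jumps_def mono_on_def)
  from total_variation_mono_on[OF this] assms u
  have tv: "bounded_variation a b ?u" "total_variation a b ?u = 2" by auto
  have f: "rs_integral f ?u a b = 0"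
    using rs_integral_eqI[OF assms has_rs_integral_endpoint_jumps[OF cont assms]] ends by simp
  have ff: "rs_integral (\<lambda>t. f t * f t) ?u a b = 2"
    using rs_integral_eqI[OF assms has_rs_integral_endpoint_jumps[OF continuous_on_mult[OF cont cont] assms]]
      ends by simp
  have "(SUP t\<in>{a..b}. f t) = 1"
    by (rule cSup_eq_maximum) (use range ends assms in \<open>auto intro!: image_eqI[of _ _ b]\<close>)
  moreover have "(INF t\<in>{a..b}. f t) = -1"
    by (rule cInf_eq_minimum) (use range ends assms in \<open>auto intro!: image_eqI[of _ _ a]\<close>)
  moreover have "(SUP t\<in>{a..b}. \<bar>f t\<bar>) = 1"
    by (rule cSup_eq_maximum)
      (use range ends assms in \<open>auto simp: abs_le_iff minus_le_iff intro!: image_eqI[of _ _ b]\<close>)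
  moreover have "{..<1::nat} = {0}" by auto
  ultimately have "max_oscillation f 1 x = 2" "max_mean_deviation f ?u 1 x = 1"
    by (simp_all add: max_oscillation_def max_mean_deviation_def x_def sup_norm_on_def rs_mean_def f)
  moreover have "interval_division a b 1 x"
    unfolding x_def by (rule interval_division_single[OF assms])
  then have "admissible a b f f ?u 1 x"
    using cont tv(1) u by (simp add: admissible_def x_def)
  moreover have "product_quadrature f f ?u 1 x = 0"
    by (simp add: product_quadrature_def x_def f)
  ultimately show ?thesis
    using that[of f f ?u 1 x] ff tv(2) by simp
qed

theorem theorem7:
  fixes a b :: real
  assumes "a < b"
  shows
    "(\<forall>f g u n x. admissible a b f g u n x \<longrightarrow>
        rs_integrable (\<lambda>t. f t * g t) u a b \<and>
        (\<forall>i<n. rs_integrable f u (x i) (x (Suc i)) \<and> rs_integrable g u (x i) (x (Suc i))) \<and>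
        (\<exists>R. rs_integral (\<lambda>t. f t * g t) u a b = product_quadrature f g u n x + R \<and>
             \<bar>R\<bar> \<le> 1/2 * max_oscillation f n x * max_mean_deviation g u n x * total_variation a b u))
     \<and> (\<forall>C<1/2. \<not> (\<forall>f g u n x. admissible a b f g u n x \<longrightarrow>
        (\<exists>R. rs_integral (\<lambda>t. f t * g t) u a b = product_quadrature f g u n x + R \<and>
             \<bar>R\<bar> \<le> C * max_oscillation f n x * max_mean_deviation g u n x * total_variation a b u)))"
proof (intro conjI allI impI)
  fix f g u n x assume adm: "admissible a b f g u n x"
  then have cont: "continuous_on {a..b} f" "continuous_on {a..b} g"
    and bv: "bounded_variation a b u" and x: "interval_division a b n x"
    by (auto simp: admissible_def)
  show "rs_integrable (\<lambda>t. f t * g t) u a b"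
    by (intro rs_integrable_continuous continuous_on_mult cont bv assms)
  have sub: "rs_integrable h u (x i) (x (Suc i))" if "i < n" "continuous_on {a..b} h" for h i
  proof (rule rs_integrable_continuous)
    note ivl = interval_division_subinterval[OF x that(1)]
    show "x i < x (Suc i)" by (rule ivl)
    show "continuous_on {x i..x (Suc i)} h" by (rule continuous_on_subset[OF that(2) ivl(2)])
    show "bounded_variation (x i) (x (Suc i)) u"
      using ivl by (intro bounded_variation_subinterval[OF bv]) auto
  qed
  show "rs_integrable f u (x i) (x (Suc i))" "rs_integrable g u (x i) (x (Suc i))" if "i < n" for i
    using sub[OF that] cont by blast+
  show "\<exists>R. rs_integral (\<lambda>t. f t * g t) u a b = product_quadrature f g u n x + R \<and>
      \<bar>R\<bar> \<le> 1/2 * max_oscillation f n x * max_mean_deviation g u n x * total_variation a b u"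
    using product_quadrature_error[OF assms adm]
    by (intro exI[of _ "rs_integral (\<lambda>t. f t * g t) u a b - product_quadrature f g u n x"]) simp
next
  fix C :: real assume C: "C < 1/2"
  obtain f g u n x where attained: "admissible a b f g u n x"
    "rs_integral (\<lambda>t. f t * g t) u a b - product_quadrature f g u n x = 2"
    "max_oscillation f n x = 2" "max_mean_deviation g u n x = 1" "total_variation a b u = 2"
    using product_quadrature_error_attained[OF assms] by blast
  show "\<not> (\<forall>f g u n x. admissible a b f g u n x \<longrightarrow>
      (\<exists>R. rs_integral (\<lambda>t. f t * g t) u a b = product_quadrature f g u n x + R \<and>
        \<bar>R\<bar> \<le> C * max_oscillation f n x * max_mean_deviation g u n x * total_variation a b u))"
  proof
    assume "\<forall>f g u n x. admissible a b f g u n x \<longrightarrow>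
      (\<exists>R. rs_integral (\<lambda>t. f t * g t) u a b = product_quadrature f g u n x + R \<and>
        \<bar>R\<bar> \<le> C * max_oscillation f n x * max_mean_deviation g u n x * total_variation a b u)"
    with attained(1) obtain R where
      R: "rs_integral (\<lambda>t. f t * g t) u a b = product_quadrature f g u n x + R"
      "\<bar>R\<bar> \<le> C * max_oscillation f n x * max_mean_deviation g u n x * total_variation a b u"
      by blast
    from R(1) attained(2) have "R = 2" by simp
    with R(2) attained(3-5) C show False by simp
  qed
qed

end
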